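(* Let $(E,\mathcal{F},\tau)$ be a real locally convex space, $\psi:E\to\mathbb{R}$ a $\tau$-continuous seminorm (e.g., $\psi\in\mathcal{F}$), $K, A\subseteq E$ nontrivial, $\tau$-closed, convex cones with normlike-bases $B_K$ and $B_A$ (with respect to $\psi$), and let $K$ be pointed. Define $S_{-K}:=\mathrm{conv}(-B_K)$ and $S_A^0:=\mathrm{conv}(B_A\cup\{0\})$. Suppose that $\mathrm{cl}_\tau\,S_{-K}$ is $\tau$-compact. Then the following assertions are equivalent: $1^\circ$ $(\mathrm{cl}_\tau\,S_A^0)\cap(\mathrm{cl}_\tau\,S_{-K})=\emptyset$. $2^\circ$ There exists $(x^*,\alpha)\in K_\tau^{a\#}\cap(E^*\times\mathbb{P})$ such that $$x^*(a)+\alpha\psi(a)\ \geq\ 0\ \geq\ x^*(k)+\alpha\psi(k)\quad\text{for all } a\in A\text{ and }k\in -K,$$ $$x^*(a)+\alpha\psi(a)\ >\ 0\ >\ x^*(k)+\alpha\psi(k)\quad\text{for all } a\in A\setminus\{0\}\text{ and }k\in -K\setminus\{0\}.$$ $3^\circ$ $A\cap(-K\setminus\{0\})=\emptyset$ and $0\notin\mathrm{cl}_\tau\,S_{-K}$.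
   Context: $(E,\mathcal{F},\tau)$ denotes a real locally convex space $E\neq\{0\}$ whose topology $\tau$ is generated by a family $\mathcal{F}$ of seminorms (not assumed Hausdorff). $E'$ is the algebraic dual and $E^*=(E,\tau)^*$ the topological dual; $\mathbb{R}_+=[0,\infty)$, $\mathbb{P}=(0,\infty)$. A set $K\subseteq E$ is a cone if $0\in K=\mathbb{R}_+\cdot K$; it is nontrivial if $\{0\}\neq K\neq E$, pointed if $K\cap(-K)=\{0\}$. A seminorm is a sublinear symmetric function $\psi:E\to\mathbb{R}$. A nontrivial cone $K$ has a normlike-base (w.r.t. $\psi$) if $\psi(x)>0$ for all $x\in K\setminus\{0\}$; the normlike-base is then $B_K:=\{x\in K\mid \psi(x)=1\}$. All normlike-bases are taken with respect to the same fixed seminorm $\psi$. $\mathrm{cl}_\tau$ is $\tau$-closure, $\mathrm{conv}$ the convex hull; $\tau$-compact means every $\tau$-open cover has a finite subcover. $-K\setminus\{0\}$ means $(-K)\setminus\{0\}$. $K^\#:=\{y'\in E'\mid \forall k\in K\setminus\{0\}:\ y'(k)>0\}$, $K^{a\#}:=\{(x',\alpha)\in K^\#\times\mathbb{R}_+\mid \forall y\in K\setminus\{0\}:\ x'(y)-\alpha\psi(y)>0\}$, and $K_\tau^{a\#}:=K^{a\#}\cap(E^*\times\mathbb{R})$. *)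

theory Defs
  imports "HOL-Analysis.Analysis"
begin

definition sublinear :: "('a::real_vector \<Rightarrow> real) \<Rightarrow> bool" where
  "sublinear p \<longleftrightarrow>
     (\<forall>x y. p (x + y) \<le> p x + p y) \<and> (\<forall>t x. 0 \<le> t \<longrightarrow> p (t *\<^sub>R x) = t * p x)"

definition seminorm :: "('a::real_vector \<Rightarrow> real) \<Rightarrow> bool" where
  "seminorm p \<longleftrightarrow> sublinear p \<and> (\<forall>x. p (- x) = p x)"

text \<open>Adding \<^term>\<open>UNIV\<close> to the subbase of open semiballs only matters for the empty
  family, where it gives the indiscrete topology instead of one with empty carrier.\<close>

definition seminorm_topology :: "('a::real_vector \<Rightarrow> real) set \<Rightarrow> 'a topology" where
  "seminorm_topology F =
     topology_generated_by (insert UNIV {{y. p (y - x) < e} | p x e. p \<in> F \<and> 0 < e})"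

lemma topspace_seminorm_topology [simp]: "topspace (seminorm_topology F) = UNIV"
  unfolding seminorm_topology_def by (auto simp: topology_generated_by_topspace)

text \<open>The space is the whole type \<^typ>\<open>'a\<close>; its topology is an explicit
  \<^typ>\<open>'a topology\<close>, not the one of a type class, and need not be Hausdorff.\<close>

definition locally_convex_space ::
    "('a::real_vector \<Rightarrow> real) set \<Rightarrow> 'a topology \<Rightarrow> bool" where
  "locally_convex_space F T \<longleftrightarrow>
     (UNIV :: 'a set) \<noteq> {0} \<and> (\<forall>p\<in>F. seminorm p) \<and> T = seminorm_topology F"

definition alg_dual :: "('a::real_vector \<Rightarrow> real) set" where
  "alg_dual = {f. linear f}"

definition top_dual :: "'a::real_vector topology \<Rightarrow> ('a \<Rightarrow> real) set" where
  "top_dual T = {f \<in> alg_dual. continuous_map T euclideanreal f}"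

text \<open>Unlike the library's \<^const>\<open>cone\<close>, this excludes the empty set.\<close>

definition is_cone :: "'a::real_vector set \<Rightarrow> bool" where
  "is_cone K \<longleftrightarrow> 0 \<in> K \<and> K = {t *\<^sub>R x | t x. 0 \<le> t \<and> x \<in> K}"

lemma is_cone_iff: "is_cone K \<longleftrightarrow> cone K \<and> 0 \<in> K"
proof
  assume "is_cone K"
  then show "cone K \<and> 0 \<in> K"
    unfolding is_cone_def cone_def by blast
next
  assume K: "cone K \<and> 0 \<in> K"
  have "x \<in> {t *\<^sub>R x | t x. 0 \<le> t \<and> x \<in> K}" if "x \<in> K" for x
    using that by (intro CollectI exI[of _ 1] exI[of _ x]) simp
  with K show "is_cone K"
    unfolding is_cone_def cone_def by blast
qed

definition nontrivial_cone :: "'a::real_vector set \<Rightarrow> bool" where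
  "nontrivial_cone K \<longleftrightarrow> is_cone K \<and> {0} \<noteq> K \<and> K \<noteq> UNIV"

definition pointed :: "'a::real_vector set \<Rightarrow> bool" where
  "pointed K \<longleftrightarrow> K \<inter> uminus ` K = {0}"

definition has_normlike_base :: "('a::real_vector \<Rightarrow> real) \<Rightarrow> 'a set \<Rightarrow> bool" where
  "has_normlike_base \<psi> K \<longleftrightarrow> nontrivial_cone K \<and> (\<forall>x\<in>K - {0}. 0 < \<psi> x)"

definition normlike_base :: "('a::real_vector \<Rightarrow> real) \<Rightarrow> 'a set \<Rightarrow> 'a set" where
  "normlike_base \<psi> K = {x \<in> K. \<psi> x = 1}"

text \<open>\<open>S_neg \<psi> K\<close> is \<open>S\<^bsub>-K\<^esub>\<close> and \<open>S_zero \<psi> A\<close> is \<open>S\<^sub>A\<^sup>0\<close>.\<close>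

definition S_neg :: "('a::real_vector \<Rightarrow> real) \<Rightarrow> 'a set \<Rightarrow> 'a set" where
  "S_neg \<psi> K = convex hull (uminus ` normlike_base \<psi> K)"

definition S_zero :: "('a::real_vector \<Rightarrow> real) \<Rightarrow> 'a set \<Rightarrow> 'a set" where
  "S_zero \<psi> A = convex hull (normlike_base \<psi> A \<union> {0})"

text \<open>The sets \<open>K\<^sup>#\<close>, \<open>K\<^bsup>a#\<^esup>\<close> and the part of the latter with continuous functionals.\<close>

definition dual_sharp :: "'a::real_vector set \<Rightarrow> ('a \<Rightarrow> real) set" where
  "dual_sharp K = {y' \<in> alg_dual. \<forall>k\<in>K - {0}. 0 < y' k}"

definition aug_dual_sharp ::
    "('a::real_vector \<Rightarrow> real) \<Rightarrow> 'a set \<Rightarrow> (('a \<Rightarrow> real) \<times> real) set" where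
  "aug_dual_sharp \<psi> K =
     {(x', \<alpha>) \<in> dual_sharp K \<times> {0..}. \<forall>y\<in>K - {0}. 0 < x' y - \<alpha> * \<psi> y}"

definition aug_dual_sharp_top ::
    "'a::real_vector topology \<Rightarrow> ('a \<Rightarrow> real) \<Rightarrow> 'a set \<Rightarrow> (('a \<Rightarrow> real) \<times> real) set" where
  "aug_dual_sharp_top T \<psi> K = aug_dual_sharp \<psi> K \<inter> (top_dual T \<times> UNIV)"

end

theory Submission
  imports Defs
begin

text \<open>The only analytic content is strict separation of a closed convex set from a disjoint
  compact convex one. Compactness yields a finite sum \<open>q\<close> of the generating seminorms and
  \<open>e > 0\<close> with \<open>q \<ge> e\<close> on the convex set \<open>M\<close> of differences; any linear functional below
  the sublinear function \<open>x \<mapsto> inf {q (x + t m) - t e | t \<ge> 0, m \<in> M}\<close> is dominated by \<open>q\<close>,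
  hence continuous, and at least \<open>e\<close> on \<open>M\<close>. The same infimum with \<open>M = {y}\<close> shows that a
  minimal sublinear function is linear, which is the Hahn-Banach theorem. Separating
  \<open>S\<^sub>A\<^sup>0\<close> from \<open>S\<^bsub>-K\<^esub>\<close> at a level \<open>-\<alpha>\<close>, negative because
  \<open>0 \<in> S\<^sub>A\<^sup>0\<close>, and scaling along rays gives \<open>1\<Longrightarrow>2\<close>; \<open>3\<Longrightarrow>1\<close> holds because the two closures
  lie in \<open>A\<close> and \<open>-K\<close>.\<close>

section \<open>Linear minorants of sublinear functions\<close>

text \<open>Applying \<open>le\<close> to the factor \<open>inverse t\<close> and the vector
  \<open>t *\<^sub>R x\<close> gives the reverse inequality. This suits functions defined as infima,
  where one bound per factor is what a lower-bound argument yields.\<close>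

lemma sublinearI:
  assumes "\<And>x y. p (x + y) \<le> p x + p y" "p 0 = 0"
    and le: "\<And>t x. 0 < t \<Longrightarrow> p (t *\<^sub>R x) \<le> t * p x"
  shows "sublinear p"
proof -
  have "p (t *\<^sub>R x) = t * p x" if "0 \<le> t" for t x
  proof (cases "t = 0")
    case False
    with that have t: "0 < t" by simp
    have "p (inverse t *\<^sub>R (t *\<^sub>R x)) \<le> inverse t * p (t *\<^sub>R x)"
      using t by (intro le) simp
    with t have "t * p x \<le> p (t *\<^sub>R x)"
      by (simp add: field_simps)
    with le[OF t] show ?thesis by (simp add: order_antisym)
  qed (use assms in simp)
  with assms(1) show ?thesis by (simp add: sublinear_def)
qed

lemma sublinear_add: "sublinear p \<Longrightarrow> p (x + y) \<le> p x + p y"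
  by (simp add: sublinear_def)

lemma sublinear_scale: "sublinear p \<Longrightarrow> 0 \<le> t \<Longrightarrow> p (t *\<^sub>R x) = t * p x"
  by (simp add: sublinear_def)

lemma sublinear_0: "sublinear p \<Longrightarrow> p 0 = 0"
  using sublinear_scale[of p 0 0] by simp

lemma sublinear_ge_uminus: "sublinear p \<Longrightarrow> - p (- x) \<le> p x"
  using sublinear_add[of p x "- x"] sublinear_0[of p] by simp

text \<open>Subadditivity at \<open>- x\<close> and \<open>- y\<close> becomes superadditivity at
  \<open>x\<close> and \<open>y\<close> once the signs are pulled out; oddness also carries
  homogeneity over to negative factors.\<close>

lemma sublinear_odd_imp_linear:
  assumes p: "sublinear p" and odd: "\<And>x. p (- x) = - p x"
  shows "linear p"
proof (rule linearI)
  fix x y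
  have "p (- x + - y) \<le> p (- x) + p (- y)"
    by (rule sublinear_add[OF p])
  moreover have "p (- x + - y) = - p (x + y)"
    using odd[of "x + y"] by simp
  ultimately show "p (x + y) = p x + p y"
    using sublinear_add[OF p, of x y] by (simp add: odd)
next
  fix t x
  show "p (t *\<^sub>R x) = t *\<^sub>R p x"
  proof (cases "0 \<le> t")
    case False
    then have "p ((- t) *\<^sub>R x) = (- t) * p x"
      by (intro sublinear_scale[OF p]) simp
    then show ?thesis using odd[of "t *\<^sub>R x"] by simp
  qed (simp add: sublinear_scale[OF p])
qed

text \<open>The value \<open>t = 0\<close> in the infimum gives \<open>p \<le> q\<close>, and
  \<open>t = 1\<close> at \<open>- m\<close> gives \<open>p (- m) \<le> - e\<close>. The bound is
  put at \<open>- m\<close> because every linear \<open>f\<close> below \<open>p\<close> then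
  satisfies \<open>f m = - f (- m) \<ge> e\<close>.\<close>

lemma sublinear_minorant_on_convex:
  fixes q :: "'a::real_vector \<Rightarrow> real"
  assumes q: "sublinear q" and M: "convex M" "M \<noteq> {}" and e: "\<And>m. m \<in> M \<Longrightarrow> e \<le> q m"
  obtains p where "sublinear p" "\<And>x. p x \<le> q x" "\<And>m. m \<in> M \<Longrightarrow> p (- m) \<le> - e"
proof -
  define V where "V x = {q (x + t *\<^sub>R m) - t * e | t m. 0 \<le> t \<and> m \<in> M}" for x
  define p where "p x = Inf (V x)" for x
  \<comment> \<open>The hypothesis \<open>e \<le> q m\<close>, scaled by \<open>t\<close>, bounds
    \<open>V x\<close> below, so that its infimum is a genuine one.\<close>
  have low: "- q (- x) \<le> v" if vV: "v \<in> V x" for x v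
  proof -
    obtain t m where v: "v = q (x + t *\<^sub>R m) - t * e" "0 \<le> t" "m \<in> M"
      using vV unfolding V_def by blast
    have "t * e \<le> q (t *\<^sub>R m)"
      using v e by (simp add: sublinear_scale[OF q] mult_left_mono)
    also have "\<dots> \<le> q (x + t *\<^sub>R m) + q (- x)"
      using sublinear_add[OF q, of "x + t *\<^sub>R m" "- x"] by simp
    finally show ?thesis using v by simp
  qed
  have bdd: "bdd_below (V x)" for x
    using low by (meson bdd_belowI)
  have ne: "V x \<noteq> {}" for x
    using M(2) unfolding V_def by (auto intro: exI[of _ 0])
  have upper: "p x \<le> q (x + t *\<^sub>R m) - t * e" if "0 \<le> t" "m \<in> M" for x t m
    unfolding p_def by (rule cInf_lower[OF _ bdd]) (use that in \<open>auto simp: V_def\<close>)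
  have greatest: "c \<le> p x" if "\<And>t m. 0 \<le> t \<Longrightarrow> m \<in> M \<Longrightarrow> c \<le> q (x + t *\<^sub>R m) - t * e" for c x
    unfolding p_def by (rule cInf_greatest[OF ne]) (use that in \<open>auto simp: V_def\<close>)
  have le_q: "p x \<le> q x" for x
    using M(2) upper[of 0] by auto
  have add: "p (x + y) \<le> p x + p y" for x y
  proof -
    have "p (x + y) - (q (x + t *\<^sub>R m) - t * e) \<le> q (y + s *\<^sub>R n) - s * e"
      if tm: "0 \<le> t" "m \<in> M" and sn: "0 \<le> s" "n \<in> M" for t m s n
    proof (cases "t + s = 0")
      case True
      with tm sn have "t = 0" "s = 0" by auto
      then show ?thesis using le_q[of "x + y"] sublinear_add[OF q, of x y] by simp
    next
      case False
      with tm sn have pos: "0 < t + s" by simp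
      \<comment> \<open>The convex combination with
        \<open>(t + s) *\<^sub>R k = t *\<^sub>R m + s *\<^sub>R n\<close>: it merges a member of
        \<open>V x\<close> and one of \<open>V y\<close> into a member of \<open>V (x + y)\<close>
        with parameter \<open>t + s\<close>.\<close>
      define k where "k = (t / (t + s)) *\<^sub>R m + (s / (t + s)) *\<^sub>R n"
      have "k \<in> M"
        unfolding k_def using tm sn pos
        by (intro convexD[OF M(1)]) (simp_all add: add_divide_distrib[symmetric])
      moreover have "(t + s) *\<^sub>R k = t *\<^sub>R m + s *\<^sub>R n"
        using pos by (simp add: k_def scaleR_right_distrib)
      ultimately have "p (x + y) \<le> q (x + y + (t *\<^sub>R m + s *\<^sub>R n)) - (t + s) * e"
        using upper[of "t + s" k "x + y"] pos by simp
      moreover have "q (x + y + (t *\<^sub>R m + s *\<^sub>R n)) \<le> q (x + t *\<^sub>R m) + q (y + s *\<^sub>R n)"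
        using sublinear_add[OF q, of "x + t *\<^sub>R m" "y + s *\<^sub>R n"] by (simp add: algebra_simps)
      ultimately show ?thesis by (simp add: algebra_simps)
    qed
    \<comment> \<open>The infimum is taken over \<open>s\<close> and \<open>n\<close> first, then
      over \<open>t\<close> and \<open>m\<close>.\<close>
    then have "p (x + y) - (q (x + t *\<^sub>R m) - t * e) \<le> p y" if "0 \<le> t" "m \<in> M" for t m
      using that by (intro greatest)
    then have "p (x + y) - p y \<le> p x"
      by (intro greatest) (simp add: algebra_simps)
    then show ?thesis by simp
  qed
  have scale: "p (t *\<^sub>R x) \<le> t * p x" if t: "0 < t" for t x
  proof -
    have "p (t *\<^sub>R x) / t \<le> q (x + s *\<^sub>R m) - s * e" if sm: "0 \<le> s" "m \<in> M" for s m
    proof -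
      have "p (t *\<^sub>R x) \<le> q (t *\<^sub>R x + (t * s) *\<^sub>R m) - (t * s) * e"
        using t sm by (intro upper) simp_all
      also have "q (t *\<^sub>R x + (t * s) *\<^sub>R m) = t * q (x + s *\<^sub>R m)"
        using sublinear_scale[OF q, of t "x + s *\<^sub>R m"] t by (simp add: scaleR_right_distrib)
      finally show ?thesis using t by (simp add: field_simps)
    qed
    then have "p (t *\<^sub>R x) / t \<le> p x" by (intro greatest)
    then show ?thesis using t by (simp add: field_simps)
  qed
  have "0 \<le> p 0"
    unfolding p_def using low[of _ 0] by (intro cInf_greatest[OF ne]) (simp add: sublinear_0[OF q])
  then have "p 0 = 0" using le_q[of 0] by (simp add: sublinear_0[OF q])
  with add scale have "sublinear p" by (intro sublinearI)
  moreover have "p (- m) \<le> - e" if "m \<in> M" for m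
    using upper[of 1 m "- m"] that by (simp add: sublinear_0[OF q])
  ultimately show ?thesis using le_q that by blast
qed

text \<open>Provides the bounds for Zorn's lemma. The estimate
  \<open>- p (- x) \<le> - q (- x) \<le> q x\<close> is uniform in \<open>q\<close>, so the
  pointwise infimum is finite. Subadditivity uses the chain: of two members \<open>q\<close> and
  \<open>r\<close> the smaller one, \<open>s\<close>, satisfies
  \<open>s (x + y) \<le> s x + s y \<le> q x + r y\<close>.\<close>

lemma sublinear_INF_chain:
  fixes C :: "('a::real_vector \<Rightarrow> real) set"
  assumes ne: "C \<noteq> {}" and sub: "\<And>q. q \<in> C \<Longrightarrow> sublinear q \<and> q \<le> p"
    and chain: "\<And>q r. q \<in> C \<Longrightarrow> r \<in> C \<Longrightarrow> q \<le> r \<or> r \<le> q"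
  shows "sublinear (\<lambda>x. INF q\<in>C. q x)" "\<And>q x. q \<in> C \<Longrightarrow> (INF q\<in>C. q x) \<le> q x"
proof -
  have "- p (- x) \<le> q x" if "q \<in> C" for q x
  proof -
    have "q (- x) \<le> p (- x)" using sub[OF that] by (simp add: le_fun_def)
    then show ?thesis using sublinear_ge_uminus[of q x] sub[OF that] by simp
  qed
  then have bdd: "bdd_below ((\<lambda>q. q x) ` C)" for x
    by (intro bdd_belowI2)
  show le: "(INF q\<in>C. q x) \<le> q x" if "q \<in> C" for q x
    by (rule cINF_lower[OF bdd that])
  show "sublinear (\<lambda>x. INF q\<in>C. q x)"
  proof (rule sublinearI)
    fix x y
    have "(INF q\<in>C. q (x + y)) - q x \<le> r y" if qr: "q \<in> C" "r \<in> C" for q r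
    proof -
      obtain s where s: "s \<in> C" "s \<le> q" "s \<le> r"
        using chain[OF qr] qr by auto
      have "s (x + y) \<le> s x + s y"
        using sub[OF s(1)] by (simp add: sublinear_add)
      also have "\<dots> \<le> q x + r y"
        using s by (intro add_mono) (simp_all add: le_fun_def)
      finally show ?thesis using le[OF s(1), of "x + y"] by simp
    qed
    then have "(INF q\<in>C. q (x + y)) - q x \<le> (INF r\<in>C. r y)" if "q \<in> C" for q
      using that by (intro cINF_greatest[OF ne])
    then have "(INF q\<in>C. q (x + y)) - (INF r\<in>C. r y) \<le> (INF q\<in>C. q x)"
      by (intro cINF_greatest[OF ne]) (simp add: algebra_simps)
    then show "(INF q\<in>C. q (x + y)) \<le> (INF q\<in>C. q x) + (INF q\<in>C. q y)"
      by simp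
  next
    have "(\<lambda>q. q 0) ` C = {0}"
      using ne sub by (auto simp: sublinear_0 image_iff)
    then show "(INF q\<in>C. q 0) = 0" by simp
  next
    fix t :: real and x :: 'a
    assume t: "0 < t"
    have "(INF q\<in>C. q (t *\<^sub>R x)) / t \<le> q x" if "q \<in> C" for q
      using le[OF that, of "t *\<^sub>R x"] sub[OF that] t
      by (simp add: sublinear_scale field_simps)
    then have "(INF q\<in>C. q (t *\<^sub>R x)) / t \<le> (INF q\<in>C. q x)"
      by (intro cINF_greatest[OF ne])
    then show "(INF q\<in>C. q (t *\<^sub>R x)) \<le> t * (INF q\<in>C. q x)"
      using t by (simp add: field_simps)
  qed
qed

lemma sublinear_linear_minorant:
  fixes p :: "'a::real_vector \<Rightarrow> real"
  assumes p: "sublinear p"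
  obtains f where "linear f" "\<And>x. f x \<le> p x"
proof -
  define S where "S = {q. sublinear q \<and> q \<le> p}"
  have "\<exists>m\<in>S. \<forall>q\<in>S. q \<le> m \<longrightarrow> q = m"
  proof (rule predicate_Zorn)
    \<comment> \<open>The order is reversed, so that upper bounds of chains are lower bounds of
      functions and a maximal element is a minimal sublinear function.\<close>
    show "partial_order_on S (relation_of (\<lambda>q r. r \<le> q) S)"
      by (rule partial_order_on_relation_ofI) auto
  next
    fix C assume "C \<in> Chains (relation_of (\<lambda>q r. r \<le> q) S)"
    then have C: "C \<subseteq> S" "\<And>q r. q \<in> C \<Longrightarrow> r \<in> C \<Longrightarrow> q \<le> r \<or> r \<le> q"
      by (auto simp: Chains_def relation_of_def)
    show "\<exists>u\<in>S. \<forall>q\<in>C. u \<le> q"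
    proof (cases "C = {}")
      case True
      then show ?thesis using p by (auto simp: S_def)
    next
      case False
      have sub: "\<And>q. q \<in> C \<Longrightarrow> sublinear q \<and> q \<le> p"
        using C(1) by (auto simp: S_def)
      let ?u = "\<lambda>x. INF q\<in>C. q x"
      have u: "sublinear ?u" "\<forall>q\<in>C. ?u \<le> q"
        using sublinear_INF_chain[OF False sub C(2)] by (simp_all add: le_fun_def)
      obtain q where "q \<in> C" using False by blast
      then have "?u \<le> p" using u(2) sub by (blast intro: order_trans)
      with u show ?thesis by (auto simp: S_def)
    qed
  qed
  then obtain m where m: "sublinear m" "m \<le> p"
    and min: "\<And>q. sublinear q \<Longrightarrow> q \<le> m \<Longrightarrow> q = m"
    unfolding S_def by (auto intro: order_trans)
  have "m (- y) = - m y" for y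
  proof -
    \<comment> \<open>With \<open>M = {y}\<close> and \<open>e = m y\<close> the condition
      \<open>e \<le> m y\<close> is an equality. Minimality forces \<open>r = m\<close>, hence
      \<open>m (- y) \<le> - m y\<close>; the converse holds for every sublinear function.\<close>
    obtain r where r: "sublinear r" "\<And>x. r x \<le> m x" "r (- y) \<le> - m y"
      using sublinear_minorant_on_convex[OF m(1), of "{y}" "m y"] by auto
    then have "r = m" by (intro min) (auto simp: le_fun_def)
    then show ?thesis
      using r(3) sublinear_ge_uminus[OF m(1), of "- y"] by simp
  qed
  then have "linear m" by (rule sublinear_odd_imp_linear[OF m(1)])
  with m(2) that show ?thesis by (auto simp: le_fun_def)
qed

lemma linear_minorant_ge_on_convex:
  fixes q :: "'a::real_vector \<Rightarrow> real"
  assumes "sublinear q" "convex M" "M \<noteq> {}" "\<And>m. m \<in> M \<Longrightarrow> e \<le> q m"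
  obtains f where "linear f" "\<And>x. f x \<le> q x" "\<And>m. m \<in> M \<Longrightarrow> e \<le> f m"
proof -
  obtain p where p: "sublinear p" "\<And>x. p x \<le> q x" "\<And>m. m \<in> M \<Longrightarrow> p (- m) \<le> - e"
    using sublinear_minorant_on_convex[OF assms] by blast
  obtain f where f: "linear f" "\<And>x. f x \<le> p x"
    using sublinear_linear_minorant[OF p(1)] by blast
  show ?thesis
  proof (rule that[OF f(1)])
    show "f x \<le> q x" for x using f(2) p(2) order_trans by blast
    show "e \<le> f m" if "m \<in> M" for m
      using f(2)[of "- m"] p(3)[OF that] linear_neg[OF f(1), of m] by simp
  qed
qed

section \<open>The topology generated by a family of seminorms\<close>

lemma seminorm_sublinear: "seminorm p \<Longrightarrow> sublinear p"
  by (simp add: seminorm_def)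

lemma seminorm_minus_commute: "seminorm p \<Longrightarrow> p (x - y) = p (y - x)"
  unfolding seminorm_def by (metis minus_diff_eq)

lemma seminorm_nonneg: "seminorm p \<Longrightarrow> 0 \<le> p x"
  using sublinear_ge_uminus[of p x] by (simp add: seminorm_def)

lemma seminorm_triangle: "seminorm p \<Longrightarrow> p (x - z) \<le> p (x - y) + p (y - z)"
  using sublinear_add[OF seminorm_sublinear, of p "x - y" "y - z"] by simp

lemma seminorm_sum:
  assumes "\<forall>p\<in>G. seminorm p"
  shows "seminorm (\<lambda>x. \<Sum>p\<in>G. p x)"
  unfolding seminorm_def sublinear_def sum.distrib[symmetric] sum_distrib_left
proof (intro conjI allI impI)
  show "(\<Sum>p\<in>G. p (x + y)) \<le> (\<Sum>p\<in>G. p x + p y)" for x y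
    using assms by (intro sum_mono sublinear_add seminorm_sublinear) blast
  show "(\<Sum>p\<in>G. p (t *\<^sub>R x)) = (\<Sum>p\<in>G. t * p x)" if "0 \<le> t" for t x
    using assms that by (intro sum.cong refl sublinear_scale seminorm_sublinear) blast
  show "(\<Sum>p\<in>G. p (- x)) = (\<Sum>p\<in>G. p x)" for x
    using assms by (intro sum.cong refl) (auto simp: seminorm_def)
qed

lemma openin_seminorm_ball:
  assumes "p \<in> F" "0 < e"
  shows "openin (seminorm_topology F) {y. p (y - x) < e}"
  unfolding seminorm_topology_def
  by (rule topology_generated_by_Basis) (use assms in blast)

lemma openin_seminorm_polyball:
  assumes "finite G" "G \<subseteq> F" "0 < e"
  shows "openin (seminorm_topology F) {y. \<forall>p\<in>G. p (y - x) < e}"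
  using assms(1,2)
proof (induction G)
  case empty
  then show ?case using openin_topspace[of "seminorm_topology F"] by simp
next
  case (insert p G)
  have "{y. \<forall>r\<in>insert p G. r (y - x) < e} = {y. p (y - x) < e} \<inter> {y. \<forall>r\<in>G. r (y - x) < e}"
    by auto
  with insert assms(3) show ?case by (simp add: openin_Int openin_seminorm_ball)
qed

text \<open>The generating semiballs form only a subbase with arbitrary centres; this description
  uses finite intersections of semiballs centred at the point itself. Intersections of open sets
  unite the finite families and take the smaller radius, which is why one radius for all of
  \<open>G\<close> suffices.\<close>

lemma openin_seminorm_topology:
  assumes F: "\<forall>p\<in>F. seminorm p"
  shows "openin (seminorm_topology F) U \<longleftrightarrow>
    (\<forall>x\<in>U. \<exists>G e. finite G \<and> G \<subseteq> F \<and> 0 < e \<and> {y. \<forall>p\<in>G. p (y - x) < e} \<subseteq> U)"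
proof (intro iffI)
  let ?B = "insert UNIV {{y. p (y - x) < e} | p x e. p \<in> F \<and> 0 < e}"
  assume "openin (seminorm_topology F) U"
  then have "generate_topology_on ?B U"
    by (simp add: seminorm_topology_def openin_topology_generated_by_iff)
  then show "\<forall>x\<in>U. \<exists>G e. finite G \<and> G \<subseteq> F \<and> 0 < e \<and> {y. \<forall>p\<in>G. p (y - x) < e} \<subseteq> U"
  proof induction
    case Empty
    then show ?case by simp
  next
    case (Int U V)
    show ?case
    proof
      fix x assume x: "x \<in> U \<inter> V"
      obtain G d where G: "finite G" "G \<subseteq> F" "0 < d" "{y. \<forall>p\<in>G. p (y - x) < d} \<subseteq> U"
        using Int x by (meson IntD1)
      obtain H e where H: "finite H" "H \<subseteq> F" "0 < e" "{y. \<forall>p\<in>H. p (y - x) < e} \<subseteq> V"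
        using Int x by (meson IntD2)
      have "{y. \<forall>p\<in>G \<union> H. p (y - x) < min d e} \<subseteq> U \<inter> V"
        using G(4) H(4) by auto
      with G H show "\<exists>G e. finite G \<and> G \<subseteq> F \<and> 0 < e \<and> {y. \<forall>p\<in>G. p (y - x) < e} \<subseteq> U \<inter> V"
        by (intro exI[of _ "G \<union> H"] exI[of _ "min d e"]) simp
    qed
  next
    case (UN \<U>)
    then show ?case by (meson Union_iff Union_upper order_trans)
  next
    case (Basis B)
    then consider "B = UNIV" | p z e where "B = {y. p (y - z) < e}" "p \<in> F" "0 < e"
      by blast
    then show ?case
    proof cases
      case 1
      \<comment> \<open>The empty family gives the whole space as a polyball, which also covers
        \<open>F = {}\<close>.\<close>
      show ?thesis
        by (auto simp: 1 intro!: exI[of _ "{}"] exI[of _ 1])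
    next
      case 2
      show ?thesis
      proof
        fix x assume "x \<in> B"
        then have x: "p (x - z) < e" using 2 by simp
        \<comment> \<open>Recentring: around \<open>x\<close> the radius left over inside the ball
          about \<open>z\<close> is \<open>e - p (x - z)\<close>.\<close>
        have "p (y - z) < e" if "p (y - x) < e - p (x - z)" for y
          using seminorm_triangle[of p y z x] 2(2) F that by fastforce
        then have "{y. p (y - x) < e - p (x - z)} \<subseteq> B"
          by (auto simp: 2(1))
        with x show "\<exists>G e. finite G \<and> G \<subseteq> F \<and> 0 < e \<and> {y. \<forall>p\<in>G. p (y - x) < e} \<subseteq> B"
          using 2(2) by (intro exI[of _ "{p}"] exI[of _ "e - p (x - z)"]) auto
      qed
    qed
  qed
next
  assume U: "\<forall>x\<in>U. \<exists>G e. finite G \<and> G \<subseteq> F \<and> 0 < e \<and> {y. \<forall>p\<in>G. p (y - x) < e} \<subseteq> U"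
  show "openin (seminorm_topology F) U"
  proof (rule openin_subopen[THEN iffD2], rule ballI)
    fix x assume "x \<in> U"
    from bspec[OF U this] obtain G e
      where G: "finite G" "G \<subseteq> F" "0 < e" "{y. \<forall>p\<in>G. p (y - x) < e} \<subseteq> U"
      by (elim exE conjE) (rule that)
    have "p (x - x) < e" if "p \<in> G" for p
      using that G(2,3) F by (auto simp: sublinear_0 seminorm_sublinear)
    with openin_seminorm_polyball[OF G(1-3), of x] G(4)
    show "\<exists>V. openin (seminorm_topology F) V \<and> x \<in> V \<and> V \<subseteq> U"
      by (intro exI[of _ "{y. \<forall>p\<in>G. p (y - x) < e}"]) simp
  qed
qed

text \<open>Negation maps the polyball about \<open>- x\<close> onto the polyball about
  \<open>x\<close> with the same radius, since seminorms are symmetric. It is needed to keep the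
  closure of \<open>S_neg \<psi> K\<close> inside \<open>- K\<close>.\<close>

lemma closedin_seminorm_topology_uminus:
  assumes F: "\<forall>p\<in>F. seminorm p" and "closedin (seminorm_topology F) K"
  shows "closedin (seminorm_topology F) (uminus ` K)"
proof -
  have K: "openin (seminorm_topology F) (- K)"
    using assms(2) by (simp add: closedin_def Compl_eq_Diff_UNIV)
  have "openin (seminorm_topology F) (- uminus ` K)"
    unfolding openin_seminorm_topology[OF F]
  proof
    fix x assume "x \<in> - uminus ` K"
    then have "- x \<in> - K"
      using imageI[of "- x" K uminus] by auto
    from K[unfolded openin_seminorm_topology[OF F], THEN bspec, OF this] obtain G e
      where G: "finite G" "G \<subseteq> F" "0 < e" "{y. \<forall>p\<in>G. p (y - - x) < e} \<subseteq> - K"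
      by (elim exE conjE) (rule that)
    have flip: "p (k - - x) = p (- k - x)" if "p \<in> G" for p k
    proof -
      have "seminorm p" using that G(2) F by blast
      then show ?thesis using seminorm_minus_commute[of p k "- x"] by (simp add: minus_diff_commute)
    qed
    have "y \<notin> uminus ` K" if y: "\<forall>p\<in>G. p (y - x) < e" for y
    proof
      assume "y \<in> uminus ` K"
      then obtain k where k: "y = - k" "k \<in> K" by blast
      have "\<forall>p\<in>G. p (k - - x) < e"
      proof
        fix p assume "p \<in> G"
        then show "p (k - - x) < e"
          using bspec[OF y] flip[of p k] unfolding k(1) by metis
      qed
      then show False using G(4) k(2) by blast
    qed
    then have "{y. \<forall>p\<in>G. p (y - x) < e} \<subseteq> - uminus ` K"
      by blast
    with G show "\<exists>G e. finite G \<and> G \<subseteq> F \<and> 0 < e \<and> {y. \<forall>p\<in>G. p (y - x) < e} \<subseteq> - uminus ` K"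
      by blast
  qed
  then show ?thesis by (simp add: closedin_def Compl_eq_Diff_UNIV)
qed

text \<open>A one-sided bound suffices: used at \<open>y - x\<close> and at \<open>x - y\<close>, it
  bounds the absolute value of \<open>f y - f x\<close> by the same sum of seminorms.\<close>

lemma continuous_map_dominated_linear:
  assumes F: "\<forall>p\<in>F. seminorm p" and G: "finite G" "G \<subseteq> F"
    and f: "linear f" "\<And>x. f x \<le> (\<Sum>p\<in>G. p x)"
  shows "continuous_map (seminorm_topology F) euclideanreal f"
proof -
  have "openin (seminorm_topology F) {x. f x \<in> V}" if V: "open V" for V
    unfolding openin_seminorm_topology[OF F]
  proof
    fix x assume "x \<in> {x. f x \<in> V}"
    then obtain e where e: "0 < e" "\<And>z. \<bar>z - f x\<bar> < e \<Longrightarrow> z \<in> V"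
      using V by (auto simp: open_dist dist_real_def)
    \<comment> \<open>The added \<open>1\<close> covers the empty \<open>G\<close> and makes
      \<open>card G * d < e\<close> strict.\<close>
    define d where "d = e / (card G + 1)"
    have d: "0 < d" "card G * d < e"
      using e(1) by (simp_all add: d_def field_simps)
    have "f y \<in> V" if y: "\<forall>p\<in>G. p (y - x) < d" for y
    proof (rule e(2))
      have sum: "(\<Sum>p\<in>G. p (y - x)) \<le> card G * d"
        using y by (intro sum_bounded_above) (simp add: less_imp_le)
      have "(\<Sum>p\<in>G. p (x - y)) = (\<Sum>p\<in>G. p (y - x))"
        using G(2) F by (intro sum.cong refl seminorm_minus_commute) blast
      with sum d(2) f(2)[of "y - x"] f(2)[of "x - y"]
      show "\<bar>f y - f x\<bar> < e" by (simp add: linear_diff[OF f(1)] abs_less_iff)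
    qed
    with G d(1)
    show "\<exists>G e. finite G \<and> G \<subseteq> F \<and> 0 < e \<and> {y. \<forall>p\<in>G. p (y - x) < e} \<subseteq> {x. f x \<in> V}"
      by (intro exI[of _ G] exI[of _ d]) auto
  qed
  then show ?thesis by (simp add: continuous_map)
qed

section \<open>Separation of closed and compact convex sets\<close>

lemma compact_closed_seminorm_gap:
  assumes F: "\<forall>p\<in>F. seminorm p"
    and C: "closedin (seminorm_topology F) C" and D: "compactin (seminorm_topology F) D"
    and disj: "C \<inter> D = {}"
  obtains G e where "finite G" "G \<subseteq> F" "0 < e"
    "\<And>c d. c \<in> C \<Longrightarrow> d \<in> D \<Longrightarrow> e \<le> (\<Sum>p\<in>G. p (c - d))"
proof -
  have oC: "openin (seminorm_topology F) (- C)"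
    using C by (simp add: closedin_def Compl_eq_Diff_UNIV)
  define R where "R d G e \<longleftrightarrow>
    finite G \<and> G \<subseteq> F \<and> 0 < e \<and> {y. \<forall>p\<in>G. p (y - d) < e} \<subseteq> - C" for d G and e :: real
  have "\<exists>G e. R d G e" if "d \<in> D" for d
  proof -
    have "d \<in> - C" using that disj by blast
    then show ?thesis
      unfolding R_def by (rule oC[unfolded openin_seminorm_topology[OF F], THEN bspec])
  qed
  then obtain G e where "\<And>d. d \<in> D \<Longrightarrow> R d (G d) (e d)"
    by metis
  then have Ge: "finite (G d) \<and> G d \<subseteq> F \<and> 0 < e d \<and> {y. \<forall>p\<in>G d. p (y - d) < e d} \<subseteq> - C"
    if "d \<in> D" for d
    using that by (simp add: R_def)
  \<comment> \<open>Half the radius leaves room for the triangle inequality: a point close to some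
    element of \<open>U d\<close> still lies in the full polyball about \<open>d\<close>, which
    misses \<open>C\<close>.\<close>
  define U where "U d = {y. \<forall>p\<in>G d. p (y - d) < e d / 2}" for d
  have oU: "openin (seminorm_topology F) (U d)" if "d \<in> D" for d
    unfolding U_def using Ge[OF that] by (intro openin_seminorm_polyball) auto
  have dU: "d \<in> U d" if "d \<in> D" for d
  proof -
    have "p (d - d) = 0" if "p \<in> G d" for p
      using that Ge[OF \<open>d \<in> D\<close>] F by (auto intro: sublinear_0 seminorm_sublinear)
    then show ?thesis using Ge[OF that] unfolding U_def by fastforce
  qed
  obtain I where I: "finite I" "I \<subseteq> D" "D \<subseteq> \<Union> (U ` I)"
  proof -
    have "\<exists>\<F>. finite \<F> \<and> \<F> \<subseteq> U ` D \<and> D \<subseteq> \<Union>\<F>"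
      using oU dU by (intro compactinD[OF D]) auto
    then show thesis using that by (metis finite_subset_image)
  qed
  define H where "H = \<Union> (G ` I)"
  \<comment> \<open>The inserted \<open>1\<close> keeps the minimum meaningful when \<open>I\<close>
    is empty.\<close>
  define m where "m = Min (insert 1 ((\<lambda>d. e d / 2) ` I))"
  have H: "finite H" "H \<subseteq> F"
    unfolding H_def using I(1,2) Ge by blast+
  have "0 < e d" if "d \<in> I" for d
    using Ge that I(2) by blast
  then have m: "0 < m"
    using I(1) by (auto simp: m_def)
  have m_le: "m \<le> e d / 2" if "d \<in> I" for d
    unfolding m_def using I(1) that by (intro Min_le) auto
  have "m \<le> (\<Sum>p\<in>H. p (c - d))" if c: "c \<in> C" and d: "d \<in> D" for c d
  proof (rule ccontr)
    assume less: "\<not> m \<le> (\<Sum>p\<in>H. p (c - d))"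
    obtain i where i: "i \<in> I" "d \<in> U i" using I(3) d by blast
    have "p (c - i) < e i" if p: "p \<in> G i" for p
    proof -
      have pH: "p \<in> H" using p i by (auto simp: H_def)
      have pF: "seminorm p" using pH H(2) F by blast
      have "p (c - d) \<le> (\<Sum>p\<in>H. p (c - d))"
        using H F by (intro member_le_sum pH) (auto intro: seminorm_nonneg)
      with less m_le[OF i(1)] have "p (c - d) < e i / 2" by linarith
      moreover have "p (d - i) < e i / 2" using i(2) p by (simp add: U_def)
      ultimately show ?thesis using seminorm_triangle[OF pF, of c i d] by linarith
    qed
    then show False using Ge[of i] i I(2) c by blast
  qed
  with H m that show ?thesis by blast
qed

text \<open>The gap \<open>e\<close> is obtained between the closures, where compactness is
  available, and then restricted to \<open>C\<close> and \<open>D\<close>, whose differences form a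
  convex set. On it a linear minorant of the finite sum of seminorms stays at least
  \<open>e\<close>.\<close>

theorem strict_separation_closed_compact:
  fixes F :: "('a::real_vector \<Rightarrow> real) set"
  assumes F: "\<forall>p\<in>F. seminorm p"
    and C: "convex C" "C \<noteq> {}" and D: "convex D" "D \<noteq> {}"
    and comp: "compactin (seminorm_topology F) (seminorm_topology F closure_of D)"
    and disj: "(seminorm_topology F closure_of C) \<inter> (seminorm_topology F closure_of D) = {}"
  obtains f s where "f \<in> top_dual (seminorm_topology F)"
    "\<And>c. c \<in> C \<Longrightarrow> s < f c" "\<And>d. d \<in> D \<Longrightarrow> f d < s"
proof -
  obtain G e where G: "finite G" "G \<subseteq> F" and e: "0 < e"
    and gap: "\<And>c d. c \<in> seminorm_topology F closure_of C \<Longrightarrow> d \<in> seminorm_topology F closure_of D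
      \<Longrightarrow> e \<le> (\<Sum>p\<in>G. p (c - d))"
    using compact_closed_seminorm_gap[OF F closedin_closure_of comp disj] by blast
  have sub: "X \<subseteq> seminorm_topology F closure_of X" for X
    by (simp add: closure_of_subset)
  let ?M = "\<Union>c\<in>C. \<Union>d\<in>D. {c - d}"
  have q: "sublinear (\<lambda>x. \<Sum>p\<in>G. p x)"
    using G(2) F by (intro seminorm_sublinear seminorm_sum) blast
  have M: "convex ?M" "?M \<noteq> {}"
    using convex_differences[OF C(1) D(1)] C(2) D(2) by blast+
  have "e \<le> (\<Sum>p\<in>G. p m)" if "m \<in> ?M" for m
    using that gap sub by blast
  then obtain f where f: "linear f" "\<And>x. f x \<le> (\<Sum>p\<in>G. p x)" "\<And>m. m \<in> ?M \<Longrightarrow> e \<le> f m"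
    using linear_minorant_ge_on_convex[OF q M] by metis
  have sep: "f d + e \<le> f c" if "c \<in> C" "d \<in> D" for c d
    using f(3)[of "c - d"] that linear_diff[OF f(1), of c d] by force
  obtain c0 where c0: "c0 \<in> C" using C(2) by blast
  have bdd: "bdd_above (f ` D)"
    using sep[OF c0] by (intro bdd_aboveI2[of _ _ "f c0 - e"]) (simp add: algebra_simps)
  show ?thesis
  proof (rule that)
    show "f \<in> top_dual (seminorm_topology F)"
      using f(1) continuous_map_dominated_linear[OF F G f(1,2)]
      by (simp add: top_dual_def alg_dual_def)
    \<comment> \<open>The threshold is the supremum over \<open>D\<close> plus half the gap: every
      \<open>f c\<close> is at least that supremum plus \<open>e\<close>, so both inequalities are
      strict.\<close>
    show "f d < (SUP d\<in>D. f d) + e / 2" if "d \<in> D" for d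
      using cSUP_upper[OF that bdd] e by simp
    show "(SUP d\<in>D. f d) + e / 2 < f c" if "c \<in> C" for c
    proof -
      have "(SUP d\<in>D. f d) \<le> f c - e"
        using sep[OF that] D(2) by (intro cSUP_least) (simp_all add: algebra_simps)
      then show ?thesis using e by simp
    qed
  qed
qed

section \<open>Normlike bases\<close>

text \<open>Lets inequalities on the base spread to all nonzero points of the cone by positive
  homogeneity.\<close>

lemma normlike_base_scale:
  assumes "seminorm \<psi>" "is_cone K" "x \<in> K" "0 < \<psi> x"
  shows "(1 / \<psi> x) *\<^sub>R x \<in> normlike_base \<psi> K"
  using assms
  by (auto simp: normlike_base_def is_cone_iff cone_def sublinear_scale seminorm_sublinear)

theorem theorem5p16:
  fixes F :: "('a::real_vector \<Rightarrow> real) set"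
    and T :: "'a topology"
    and \<psi> :: "'a \<Rightarrow> real"
    and K A :: "'a set"
  assumes "locally_convex_space F T"
    and "seminorm \<psi>" and "continuous_map T euclideanreal \<psi>"
    and "nontrivial_cone K" and "closedin T K" and "convex K"
    and "nontrivial_cone A" and "closedin T A" and "convex A"
    and "has_normlike_base \<psi> K" and "has_normlike_base \<psi> A"
    and "pointed K"
    and "compactin T (T closure_of S_neg \<psi> K)"
  defines "P1 \<equiv> (T closure_of S_zero \<psi> A) \<inter> (T closure_of S_neg \<psi> K) = {}"
    and "P2 \<equiv> (\<exists>(x', \<alpha>) \<in> aug_dual_sharp_top T \<psi> K \<inter> (top_dual T \<times> {0<..}).
        (\<forall>a\<in>A. \<forall>k\<in>uminus ` K.
           x' a + \<alpha> * \<psi> a \<ge> 0 \<and> 0 \<ge> x' k + \<alpha> * \<psi> k) \<and>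
        (\<forall>a\<in>A - {0}. \<forall>k\<in>uminus ` K - {0}.
           x' a + \<alpha> * \<psi> a > 0 \<and> 0 > x' k + \<alpha> * \<psi> k))"
    and "P3 \<equiv> A \<inter> (uminus ` K - {0}) = {} \<and> 0 \<notin> T closure_of S_neg \<psi> K"
  shows "(P1 \<longleftrightarrow> P2) \<and> (P2 \<longleftrightarrow> P3)"
proof -
  have F: "\<forall>p\<in>F. seminorm p"
    using assms(1) by (simp add: locally_convex_space_def)
  have T: "T = seminorm_topology F"
    using assms(1) by (simp add: locally_convex_space_def)
  have cone: "is_cone K" "is_cone A" "K \<noteq> {0}"
    using assms(4,7) by (auto simp: nontrivial_cone_def)
  have \<psi>_neg: "\<psi> (- x) = \<psi> x" for x
    using assms(2) by (simp add: seminorm_def)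
  have \<psi>_0: "\<psi> 0 = 0"
    using assms(2) by (simp add: sublinear_0 seminorm_sublinear)
  have posK: "0 < \<psi> x" if "x \<in> K - {0}" for x
    using assms(10) that by (simp add: has_normlike_base_def)
  have posA: "0 < \<psi> x" if "x \<in> A - {0}" for x
    using assms(11) that by (simp add: has_normlike_base_def)
  have "P2" if P1
  proof -
    have "S_zero \<psi> A \<noteq> {}"
      by (simp add: S_zero_def)
    moreover have "S_neg \<psi> K \<noteq> {}"
    proof -
      obtain k where "k \<in> K - {0}" using cone by (auto simp: is_cone_iff)
      then have "(1 / \<psi> k) *\<^sub>R k \<in> normlike_base \<psi> K"
        using posK by (intro normlike_base_scale assms(2) cone) auto
      then show ?thesis by (auto simp: S_neg_def)
    qed
    ultimately obtain f s where f: "f \<in> top_dual T"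
      and fs: "\<And>c. c \<in> S_zero \<psi> A \<Longrightarrow> s < f c" "\<And>d. d \<in> S_neg \<psi> K \<Longrightarrow> f d < s"
      using strict_separation_closed_compact[of F "S_zero \<psi> A" "S_neg \<psi> K"]
        F assms(13) \<open>P1\<close> unfolding T P1_def
      by (metis S_neg_def S_zero_def convex_convex_hull)
    define \<alpha> where "\<alpha> = - s"
    have s: "\<And>c. c \<in> S_zero \<psi> A \<Longrightarrow> - \<alpha> < f c" "\<And>d. d \<in> S_neg \<psi> K \<Longrightarrow> f d < - \<alpha>"
      using fs by (simp_all add: \<alpha>_def)
    have lin: "linear f" using f by (simp add: top_dual_def alg_dual_def)
    have "0 \<in> S_zero \<psi> A" by (simp add: S_zero_def hull_inc)
    then have s0: "0 < \<alpha>" using s(1)[of 0] linear_0[OF lin] by simp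
    have fA: "0 < f a + \<alpha> * \<psi> a" if "a \<in> A - {0}" for a
    proof -
      have "(1 / \<psi> a) *\<^sub>R a \<in> normlike_base \<psi> A"
        using that posA by (intro normlike_base_scale assms(2) cone) auto
      then have "- \<alpha> < f ((1 / \<psi> a) *\<^sub>R a)"
        by (intro s(1)) (simp add: S_zero_def hull_inc)
      then show ?thesis using posA[OF that] by (simp add: linear_scale[OF lin] field_simps)
    qed
    have fK: "0 < f k - \<alpha> * \<psi> k" if "k \<in> K - {0}" for k
    proof -
      have "(1 / \<psi> k) *\<^sub>R k \<in> normlike_base \<psi> K"
        using that posK by (intro normlike_base_scale assms(2) cone) auto
      then have "f (- ((1 / \<psi> k) *\<^sub>R k)) < - \<alpha>"
        by (intro s(2)) (simp add: S_neg_def hull_inc)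
      then show ?thesis
        using posK[OF that] by (simp add: linear_scale[OF lin] linear_neg[OF lin] field_simps)
    qed
    \<comment> \<open>By symmetry of \<open>\<psi>\<close> the value at \<open>- y\<close> is the
      negative of \<open>f y - \<alpha> * \<psi> y\<close>.\<close>
    have fmK: "f k + \<alpha> * \<psi> k < 0" if "k \<in> uminus ` K - {0}" for k
    proof -
      obtain y where "k = - y" "y \<in> K - {0}" using \<open>k \<in> uminus ` K - {0}\<close> by auto
      with fK[of y] show ?thesis by (simp add: linear_neg[OF lin] \<psi>_neg)
    qed
    \<comment> \<open>At the origin both sides vanish, so the weak inequalities follow from the
      strict ones.\<close>
    have f0: "f 0 + \<alpha> * \<psi> 0 = 0"
      by (simp add: linear_0[OF lin] \<psi>_0)
    have "0 \<le> f a + \<alpha> * \<psi> a" if "a \<in> A" for a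
      using fA[of a] f0 that by (cases "a = 0") auto
    moreover have "f k + \<alpha> * \<psi> k \<le> 0" if "k \<in> uminus ` K" for k
      using fmK[of k] f0 that by (cases "k = 0") auto
    moreover have "0 < f k" if "k \<in> K - {0}" for k
    proof -
      have "0 < \<alpha> * \<psi> k" using s0 posK[OF that] by (rule mult_pos_pos)
      then show ?thesis using fK[OF that] by simp
    qed
    then have "(f, \<alpha>) \<in> aug_dual_sharp_top T \<psi> K \<inter> (top_dual T \<times> {0<..})"
      using f s0 fK lin
      by (simp add: aug_dual_sharp_top_def aug_dual_sharp_def dual_sharp_def alg_dual_def)
    ultimately show P2
      using fA fmK unfolding P2_def by (intro bexI[of _ "(f, \<alpha>)"]) auto
  qed
  moreover have "P3" if P2
  proof -
    obtain f \<alpha> where f: "f \<in> top_dual T" "0 < \<alpha>" "\<forall>y\<in>K - {0}. 0 < f y - \<alpha> * \<psi> y"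
      and sep: "\<forall>a\<in>A - {0}. \<forall>k\<in>uminus ` K - {0}. f a + \<alpha> * \<psi> a > 0 \<and> 0 > f k + \<alpha> * \<psi> k"
      using \<open>P2\<close> unfolding P2_def aug_dual_sharp_top_def aug_dual_sharp_def by auto
    have lin: "linear f" using f(1) by (simp add: top_dual_def alg_dual_def)
    \<comment> \<open>The open half-space \<open>- \<alpha> < f x\<close> contains \<open>0\<close>
      because \<open>\<alpha>\<close> is positive. It misses \<open>- B_K\<close>, where
      \<open>\<psi>\<close> equals 1, hence also the convex hull and, being open, the
      closure.\<close>
    have "openin T {x \<in> topspace T. f x \<in> {- \<alpha><..}}"
      using f(1) by (intro openin_continuous_map_preimage[of _ euclideanreal]) (auto simp: top_dual_def)
    then have op: "openin T {x. - \<alpha> < f x}" by (simp add: T)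
    have "uminus ` normlike_base \<psi> K \<subseteq> f -` {..- \<alpha>}"
    proof
      fix x assume "x \<in> uminus ` normlike_base \<psi> K"
      then obtain y where y: "x = - y" "y \<in> K" "\<psi> y = 1"
        by (auto simp: normlike_base_def)
      then have "y \<in> K - {0}" using \<psi>_0 by auto
      with f(3) have "0 < f y - \<alpha> * \<psi> y" by blast
      then show "x \<in> f -` {..- \<alpha>}" using y by (simp add: linear_neg[OF lin])
    qed
    then have "S_neg \<psi> K \<subseteq> f -` {..- \<alpha>}"
      unfolding S_neg_def by (intro hull_minimal convex_linear_vimage[OF lin]) auto
    then have "{x. - \<alpha> < f x} \<inter> T closure_of S_neg \<psi> K = {}"
      unfolding openin_Int_closure_of_eq_empty[OF op] by auto
    moreover have "0 \<in> {x. - \<alpha> < f x}" using f(2) by (simp add: linear_0[OF lin])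
    ultimately have "0 \<notin> T closure_of S_neg \<psi> K"
      by blast
    moreover have "A \<inter> (uminus ` K - {0}) = {}"
    proof (rule ccontr)
      assume "A \<inter> (uminus ` K - {0}) \<noteq> {}"
      then obtain x where x: "x \<in> A - {0}" "x \<in> uminus ` K - {0}" by blast
      \<comment> \<open>The common point serves as both \<open>a\<close> and \<open>k\<close>, so
        the same number would be positive and negative.\<close>
      show False using sep[rule_format, OF x] by linarith
    qed
    ultimately show P3 by (simp add: P3_def)
  qed
  moreover have "P1" if P3
  proof -
    have "S_zero \<psi> A \<subseteq> A"
      unfolding S_zero_def using cone(2) assms(9)
      by (intro hull_minimal) (auto simp: normlike_base_def is_cone_iff)
    then have clA: "T closure_of S_zero \<psi> A \<subseteq> A"
      by (rule closure_of_minimal[OF _ assms(8)])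
    have "S_neg \<psi> K \<subseteq> uminus ` K"
      unfolding S_neg_def using convex_negations[OF assms(6)]
      by (intro hull_minimal) (auto simp: normlike_base_def)
    then have clK: "T closure_of S_neg \<psi> K \<subseteq> uminus ` K"
      by (rule closure_of_minimal)
        (use assms(5) closedin_seminorm_topology_uminus[OF F] in \<open>simp add: T\<close>)
    show P1
      unfolding P1_def
    proof (rule equals0I)
      fix x assume x: "x \<in> T closure_of S_zero \<psi> A \<inter> T closure_of S_neg \<psi> K"
      \<comment> \<open>The closures may meet only within \<open>A\<close> and \<open>- K\<close>,
        so by the first half of \<open>P3\<close> only at \<open>0\<close>, which its second half
        excludes.\<close>
      have "x \<noteq> 0" using x \<open>P3\<close> by (auto simp only: P3_def)
      then have "x \<in> A \<inter> (uminus ` K - {0})" using x clA clK by blast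
      then show False using \<open>P3\<close> unfolding P3_def by (elim conjE) simp
    qed
  qed
  ultimately show ?thesis by blast
qed

end
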